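(* Consider the Test and Find problem with parameters $n,k,m$, $(a_i),(b_i),(c_i),(d_i)$ and prior distribution $\pi$ (as described in the context). For $s\in\Sigma$ with $p(s|\pi):=\sum_{\gamma\in\Gamma}\pi(\gamma)p(s|\gamma)>0$ and $i\in\{1,\dots,n\}$ put $$\alpha_i(s,\pi)=\frac{\sum_{\gamma\in\Gamma:\gamma_i=0}\pi(\gamma)p(s|\gamma)}{\sum_{\gamma\in\Gamma}\pi(\gamma)p(s|\gamma)},\qquad R_i(s,\pi)=c_i-(c_i+d_i)\alpha_i(s,\pi).$$ Let $\mathcal I:\Sigma\to\{I\subseteq\{1,\dots,n\}:|I|\le m\}$ be any strategy such that for every $s$ with $p(s|\pi)>0$ the following holds, where $\ell$ denotes the number of indices $i$ with $R_i(s,\pi)>0$: if $\ell\le m$, then $\mathcal I(s)=\{i:R_i(s,\pi)>0\}$; if $\ell>m$, then $\mathcal I(s)$ consists of $m$ indices with the largest values of $R_i(s,\pi)$ (ties broken arbitrarily). Then $\mathcal I$ is optimal: it maximizes the expected total reward $$\mathrm E\Big[\sum_{i\in\mathcal J(S)}\big(c_i1_{[T_i=1]}-d_i1_{[T_i=0]}\big)\Big]$$ among all strategies $\mathcal J:\Sigma\to\{I\subseteq\{1,\dots,n\}:|I|\le m\}$.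
   Context: Let $n\ge1$, $0\le k\le n$, $1\le m\le n$ be integers, let $a_i,b_i\in[1/2,1]$ and let $c_i,d_i$ be real numbers for $i=1,\dots,n$. Here $c_i$ is the reward for a correct tag in box $i$ and $d_i$ the penalty for a wrong tag in box $i$. Let $\Gamma=\{\gamma\in\{0,1\}^n:\sum_j\gamma_j=k\}$ (allocations of $k$ identical objects to $n$ boxes, at most one per box) and $\Sigma=\{0,1\}^n$ (signals). $T=(T_1,\dots,T_n)$ is a $\Gamma$-valued random vector with distribution $\pi$ (an arbitrary probability measure on $\Gamma$); $T_i=1$ means box $i$ contains an object. $S=(S_1,\dots,S_n)$ is the $\Sigma$-valued vector of test results; $S_i=1$ means the test of box $i$ is positive. Conditionally on $T=\gamma$, the $S_i$ are independent, with $P(S_i=1|T=\gamma)=a_i$ if $\gamma_i=1$ and $P(S_i=0|T=\gamma)=b_i$ if $\gamma_i=0$. Write $p(s|\gamma)=P(S=s|T=\gamma)$, the corresponding conditional probability mass function, defined by this mechanism for every $\gamma\in\Gamma$, so that $$p(s|\gamma)=\prod_{i:\gamma_i=1}a_i^{s_i}(1-a_i)^{1-s_i}\prod_{i:\gamma_i=0}b_i^{1-s_i}(1-b_i)^{s_i}\qquad(0^0=1).$$ The decision maker knows all parameters, observes only $S$ (not $T$), and then may tag at most $m$ boxes. A strategy is a function assigning to each signal $s\in\Sigma$ the set of tagged boxes, of size at most $m$. The total reward is the sum over tagged boxes $i$ of $c_i$ if $T_i=1$ and $-d_i$ if $T_i=0$. *)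

theory Defs
  imports "HOL-Probability.Probability"
begin

text \<open>
  Vectors in \<open>{0,1}\<^sup>n\<close> are extensional functions on \<open>{1..n}\<close>, so that the sets below are
  finite and equality of vectors is equality of functions.
\<close>

definition signals :: "nat \<Rightarrow> (nat \<Rightarrow> nat) set" where
  "signals n = {1..n} \<rightarrow>\<^sub>E {0, 1}"

definition allocations :: "nat \<Rightarrow> nat \<Rightarrow> (nat \<Rightarrow> nat) set" where
  "allocations n k = {\<gamma> \<in> {1..n} \<rightarrow>\<^sub>E {0, 1}. (\<Sum>j = 1..n. \<gamma> j) = k}"

text \<open>
  The conditional distribution of \<open>S\<close> given \<open>T = \<gamma>\<close> is constrained only for those \<open>\<gamma>\<close> that occur
  with positive probability. The measure \<open>uniform_measure M A\<close> is \<open>M\<close> conditioned on the event \<open>A\<close>.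
\<close>

locale test_and_find = prob_space M
  for M :: "'w measure" +
  fixes n k m :: nat
    and a b :: "nat \<Rightarrow> real"
    and \<pi> :: "(nat \<Rightarrow> nat) pmf"
    and T S :: "'w \<Rightarrow> nat \<Rightarrow> nat"
  assumes n_ge_1: "1 \<le> n"
    and k_le_n: "k \<le> n"
    and m_ge_1: "1 \<le> m"
    and m_le_n: "m \<le> n"
    and a_range: "\<And>i. i \<in> {1..n} \<Longrightarrow> a i \<in> {1/2..1}"
    and b_range: "\<And>i. i \<in> {1..n} \<Longrightarrow> b i \<in> {1/2..1}"
    and prior_on_allocations: "set_pmf \<pi> \<subseteq> allocations n k"
    and measurable_T: "T \<in> M \<rightarrow>\<^sub>M count_space (allocations n k)"
    and measurable_S: "S \<in> M \<rightarrow>\<^sub>M count_space (signals n)"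
    and distr_T: "distr M (count_space UNIV) T = measure_pmf \<pi>"
    and cond_indep:
      "\<And>\<gamma>. \<gamma> \<in> allocations n k \<Longrightarrow> \<P>(\<omega> in M. T \<omega> = \<gamma>) > 0 \<Longrightarrow>
        prob_space.indep_vars (uniform_measure M {\<omega> \<in> space M. T \<omega> = \<gamma>})
          (\<lambda>i. count_space {0, 1}) (\<lambda>i \<omega>. S \<omega> i) {1..n}"
    and cond_prob_1:
      "\<And>\<gamma> i. \<gamma> \<in> allocations n k \<Longrightarrow> \<P>(\<omega> in M. T \<omega> = \<gamma>) > 0 \<Longrightarrow> i \<in> {1..n} \<Longrightarrow> \<gamma> i = 1 \<Longrightarrow>
        \<P>(\<omega> in M. S \<omega> i = 1 \<bar> T \<omega> = \<gamma>) = a i"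
    and cond_prob_0:
      "\<And>\<gamma> i. \<gamma> \<in> allocations n k \<Longrightarrow> \<P>(\<omega> in M. T \<omega> = \<gamma>) > 0 \<Longrightarrow> i \<in> {1..n} \<Longrightarrow> \<gamma> i = 0 \<Longrightarrow>
        \<P>(\<omega> in M. S \<omega> i = 0 \<bar> T \<omega> = \<gamma>) = b i"

definition likelihood ::
  "nat \<Rightarrow> (nat \<Rightarrow> real) \<Rightarrow> (nat \<Rightarrow> real) \<Rightarrow> (nat \<Rightarrow> nat) \<Rightarrow> (nat \<Rightarrow> nat) \<Rightarrow> real" where
  "likelihood n a b s \<gamma> =
     (\<Prod>i \<in> {i \<in> {1..n}. \<gamma> i = 1}. a i ^ s i * (1 - a i) ^ (1 - s i)) *
     (\<Prod>i \<in> {i \<in> {1..n}. \<gamma> i = 0}. b i ^ (1 - s i) * (1 - b i) ^ s i)"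

text \<open>
  The product formula is the conditional probability mass function of \<open>S\<close> given \<open>T = \<gamma>\<close> wherever
  the latter exists; \<^const>\<open>likelihood\<close> also covers allocations of prior probability zero.
\<close>

lemma (in test_and_find) cond_prob_signal:
  assumes g: "\<gamma> \<in> allocations n k" and s: "s \<in> signals n"
    and pos: "\<P>(\<omega> in M. T \<omega> = \<gamma>) > 0"
  shows "\<P>(\<omega> in M. S \<omega> = s \<bar> T \<omega> = \<gamma>) = likelihood n a b s \<gamma>"
proof -
  define A where "A = {\<omega> \<in> space M. T \<omega> = \<gamma>}"
  define N where "N = uniform_measure M A"
  have A: "A \<in> events"
  proof -
    have "A = T -` {\<gamma>} \<inter> space M" by (auto simp: A_def)
    thus ?thesis using measurable_sets[OF measurable_T, of "{\<gamma>}"] g by simp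
  qed
  have pA: "prob A > 0" using pos by (simp add: A_def)
  have N: "prob_space N" unfolding N_def
    by (rule prob_space_uniform_measure) (use pA in \<open>auto simp: emeasure_eq_measure\<close>)
  interpret N: prob_space N by (rule N)
  have sN: "space N = space M" by (simp add: N_def)
  have Sev: "{\<omega> \<in> space M. S \<omega> \<in> X} \<in> events" for X
  proof -
    have "{\<omega> \<in> space M. S \<omega> \<in> X} = S -` (X \<inter> signals n) \<inter> space M"
      using measurable_space[OF measurable_S] by auto
    thus ?thesis using measurable_sets[OF measurable_S, of "X \<inter> signals n"] by simp
  qed
  have cond: "\<P>(\<omega> in M. S \<omega> \<in> X \<bar> T \<omega> = \<gamma>) = measure N {\<omega> \<in> space M. S \<omega> \<in> X}" for X
  proof -
    have "measure N {\<omega> \<in> space M. S \<omega> \<in> X} = prob (A \<inter> {\<omega> \<in> space M. S \<omega> \<in> X}) / prob A"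
      unfolding N_def using A Sev pA
      by (intro measure_uniform_measure) (auto simp: emeasure_eq_measure)
    moreover have "A \<inter> {\<omega> \<in> space M. S \<omega> \<in> X} = {\<omega> \<in> space M. S \<omega> \<in> X \<and> T \<omega> = \<gamma>}"
      by (auto simp: A_def)
    ultimately show ?thesis by (simp add: cond_prob_def A_def)
  qed
  have c1: "\<P>(\<omega> in M. S \<omega> i = v \<bar> T \<omega> = \<gamma>) = measure N {\<omega> \<in> space M. S \<omega> i = v}" for i v
    using cond[of "{f. f i = v}"] by simp
  have c2: "\<P>(\<omega> in M. S \<omega> = s \<bar> T \<omega> = \<gamma>) = measure N {\<omega> \<in> space M. S \<omega> = s}"
    using cond[of "{s}"] by simp
  have Sv: "S \<omega> i = 0 \<or> S \<omega> i = 1" if "\<omega> \<in> space M" "i \<in> {1..n}" for \<omega> i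
    using measurable_space[OF measurable_S that(1)] that(2)
    by (auto simp: signals_def PiE_iff)
  have sv: "s i = 0 \<or> s i = 1" if "i \<in> {1..n}" for i
    using s that by (auto simp: signals_def PiE_iff)
  have gv: "\<gamma> i = 0 \<or> \<gamma> i = 1" if "i \<in> {1..n}" for i
    using g that by (auto simp: allocations_def PiE_iff)
  have n0: "{1..n} \<noteq> {}" using n_ge_1 by auto
  have ind: "N.indep_vars (\<lambda>i. count_space {0, 1}) (\<lambda>i \<omega>. S \<omega> i) {1..n}"
    using cond_indep[OF g pos] by (simp add: N_def A_def)
  have "{\<omega> \<in> space M. S \<omega> = s} = (\<Inter>i\<in>{1..n}. (\<lambda>\<omega>. S \<omega> i) -` {s i} \<inter> space N)"
  proof (intro equalityI subsetI)
    fix w assume "w \<in> (\<Inter>i\<in>{1..n}. (\<lambda>\<omega>. S \<omega> i) -` {s i} \<inter> space N)"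
    hence w: "w \<in> space M" "\<And>i. i \<in> {1..n} \<Longrightarrow> S w i = s i"
      using n0 by (auto simp: sN)
    have "S w = s"
      using measurable_space[OF measurable_S w(1)] s w(2)
      unfolding signals_def space_count_space by (rule PiE_ext)
    thus "w \<in> {\<omega> \<in> space M. S \<omega> = s}" using w by simp
  qed (auto simp: sN)
  hence "measure N {\<omega> \<in> space M. S \<omega> = s}
      = (\<Prod>i\<in>{1..n}. measure N ((\<lambda>\<omega>. S \<omega> i) -` {s i} \<inter> space N))"
    using N.indep_varsD[OF ind, of "{1..n}" "\<lambda>i. {s i}"] n0 sv by auto
  also have "\<dots> = (\<Prod>i\<in>{1..n}. if \<gamma> i = 1 then a i ^ s i * (1 - a i) ^ (1 - s i)
                  else b i ^ (1 - s i) * (1 - b i) ^ s i)"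
  proof (rule prod.cong, simp)
    fix i assume i: "i \<in> {1..n}"
    have e: "(\<lambda>\<omega>. S \<omega> i) -` {v} \<inter> space N = {\<omega> \<in> space M. S \<omega> i = v}" for v
      by (auto simp: sN)
    have ev: "{\<omega> \<in> space M. S \<omega> i = v} \<in> N.events" for v
      using Sev[of "{f. f i = v}"] by (simp add: N_def)
    have "{\<omega> \<in> space M. S \<omega> i = 0} = space N - {\<omega> \<in> space M. S \<omega> i = 1}"
      using Sv[OF _ i] by (force simp: sN)
    hence "measure N {\<omega> \<in> space M. S \<omega> i = 0} = 1 - measure N {\<omega> \<in> space M. S \<omega> i = 1}"
      using N.prob_compl[OF ev[of 1]] by simp
    moreover have "\<gamma> i = 1 \<Longrightarrow> measure N {\<omega> \<in> space M. S \<omega> i = 1} = a i"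
      using cond_prob_1[OF g pos i] c1 by simp
    moreover have "\<gamma> i = 0 \<Longrightarrow> measure N {\<omega> \<in> space M. S \<omega> i = 0} = b i"
      using cond_prob_0[OF g pos i] c1 by simp
    ultimately show "measure N ((\<lambda>\<omega>. S \<omega> i) -` {s i} \<inter> space N) =
      (if \<gamma> i = 1 then a i ^ s i * (1 - a i) ^ (1 - s i) else b i ^ (1 - s i) * (1 - b i) ^ s i)"
      unfolding e using sv[OF i] gv[OF i] by auto
  qed
  also have "\<dots> = likelihood n a b s \<gamma>"
  proof -
    have "{i \<in> {1..n}. \<gamma> i \<noteq> 1} = {i \<in> {1..n}. \<gamma> i = 0}"
      using gv by force
    thus ?thesis unfolding likelihood_def by (subst prod.If_cases) (auto simp: Int_def Collect_conj_eq[symmetric] Compl_eq)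
  qed
  finally show ?thesis by (simp add: c2)
qed

definition signal_prob ::
  "nat \<Rightarrow> nat \<Rightarrow> (nat \<Rightarrow> real) \<Rightarrow> (nat \<Rightarrow> real) \<Rightarrow> (nat \<Rightarrow> nat) pmf \<Rightarrow> (nat \<Rightarrow> nat) \<Rightarrow> real" where
  "signal_prob n k a b \<pi> s = (\<Sum>\<gamma> \<in> allocations n k. pmf \<pi> \<gamma> * likelihood n a b s \<gamma>)"

definition posterior_empty ::
  "nat \<Rightarrow> nat \<Rightarrow> (nat \<Rightarrow> real) \<Rightarrow> (nat \<Rightarrow> real) \<Rightarrow> (nat \<Rightarrow> nat) pmf \<Rightarrow> (nat \<Rightarrow> nat) \<Rightarrow> nat \<Rightarrow> real" where
  "posterior_empty n k a b \<pi> s i =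
     (\<Sum>\<gamma> \<in> {\<gamma> \<in> allocations n k. \<gamma> i = 0}. pmf \<pi> \<gamma> * likelihood n a b s \<gamma>) /
     (\<Sum>\<gamma> \<in> allocations n k. pmf \<pi> \<gamma> * likelihood n a b s \<gamma>)"

definition tag_value ::
  "nat \<Rightarrow> nat \<Rightarrow> (nat \<Rightarrow> real) \<Rightarrow> (nat \<Rightarrow> real) \<Rightarrow> (nat \<Rightarrow> real) \<Rightarrow> (nat \<Rightarrow> real) \<Rightarrow>
    (nat \<Rightarrow> nat) pmf \<Rightarrow> (nat \<Rightarrow> nat) \<Rightarrow> nat \<Rightarrow> real" where
  "tag_value n k a b c d \<pi> s i = c i - (c i + d i) * posterior_empty n k a b \<pi> s i"

definition strategies :: "nat \<Rightarrow> nat \<Rightarrow> ((nat \<Rightarrow> nat) \<Rightarrow> nat set) set" where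
  "strategies n m = signals n \<rightarrow> {I. I \<subseteq> {1..n} \<and> card I \<le> m}"

definition expected_reward ::
  "'w measure \<Rightarrow> (nat \<Rightarrow> real) \<Rightarrow> (nat \<Rightarrow> real) \<Rightarrow> ('w \<Rightarrow> nat \<Rightarrow> nat) \<Rightarrow> ('w \<Rightarrow> nat \<Rightarrow> nat) \<Rightarrow>
    ((nat \<Rightarrow> nat) \<Rightarrow> nat set) \<Rightarrow> real" where
  "expected_reward M c d T S J =
     (\<integral>\<omega>. (\<Sum>i \<in> J (S \<omega>). c i * of_bool (T \<omega> i = 1) - d i * of_bool (T \<omega> i = 0)) \<partial>M)"

definition largest_indices :: "nat \<Rightarrow> nat \<Rightarrow> (nat \<Rightarrow> real) \<Rightarrow> nat set \<Rightarrow> bool" where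
  "largest_indices n m R I \<longleftrightarrow>
     I \<subseteq> {1..n} \<and> card I = m \<and> (\<forall>i \<in> I. \<forall>j \<in> {1..n} - I. R j \<le> R i)"

definition greedy_choice :: "nat \<Rightarrow> nat \<Rightarrow> (nat \<Rightarrow> real) \<Rightarrow> nat set \<Rightarrow> bool" where
  "greedy_choice n m R I \<longleftrightarrow>
     (let P = {i \<in> {1..n}. R i > 0}; l = card P
      in (l \<le> m \<longrightarrow> I = P) \<and> (l > m \<longrightarrow> largest_indices n m R I))"

end

theory Submission
  imports Defs
begin

text \<open>
  The strategy may depend on the signal in an arbitrary way, so the expected reward can be maximized
  separately for each signal. By Bayes' rule, given \<open>S = s\<close> box \<open>i\<close> is empty with probability
  \<open>\<alpha>\<^sub>i(s,\<pi>)\<close>, so the conditional mean reward of tagging it is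
  \<open>c\<^sub>i (1 - \<alpha>\<^sub>i) - d\<^sub>i \<alpha>\<^sub>i = R\<^sub>i(s,\<pi>)\<close>. The reward is additive over the tagged boxes, whence the
  expected reward of \<open>J\<close> is \<open>\<Sum>\<^sub>s p(s|\<pi>) \<Sum>\<^sub>i\<^sub>\<in>\<^sub>J\<^sub>(\<^sub>s\<^sub>) R\<^sub>i(s,\<pi>)\<close>
  (lemma \<open>expected_reward_eq_sum_tag_values\<close>); signals of probability zero contribute nothing.

  It remains to choose at most \<open>m\<close> of finitely many numbers with the largest possible sum
  (lemma \<open>greedy_choice_maximizes_sum\<close>). The greedy set separates the numbers by a threshold
  \<open>t \<ge> 0\<close>: those inside are at least \<open>t\<close>, those outside at most \<open>t\<close>, and either all \<open>m\<close> places are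
  taken or \<open>t = 0\<close>. Passing to a competing set replaces numbers that are at least \<open>t\<close> by numbers
  that are at most \<open>t\<close>; if the competitor is larger, then \<open>t = 0\<close> and the additional numbers do not
  help.
\<close>

section \<open>Choosing a bounded number of terms with the largest sum\<close>

lemma sum_le_sum_if_threshold:
  fixes R :: "'a \<Rightarrow> real"
  assumes "finite I" "finite J"
    and t: "0 \<le> t"
    and inside: "\<And>i. i \<in> I - J \<Longrightarrow> t \<le> R i"
    and outside: "\<And>j. j \<in> J - I \<Longrightarrow> R j \<le> t"
    and full: "card J \<le> card I \<or> t = 0"
  shows "sum R J \<le> sum R I"
proof -
  have "sum R (J - I) \<le> real (card (J - I)) * t"
    using outside by (rule sum_bounded_above)
  also have "\<dots> \<le> real (card (I - J)) * t"
  proof (cases "t = 0")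
    case False
    with full have "card J \<le> card I" by simp
    then have "card (J - I) \<le> card (I - J)"
      using card_le_sym_Diff[of J I] assms(1,2) by simp
    with t show ?thesis by (intro mult_right_mono) auto
  qed simp
  also have "\<dots> \<le> sum R (I - J)"
    using inside by (rule sum_bounded_below)
  finally show ?thesis
    using sum.Int_Diff[of J R I] sum.Int_Diff[of I R J] assms(1,2)
    by (simp add: Int_commute)
qed

lemma greedy_choice_maximizes_sum:
  assumes greedy: "greedy_choice n m R I" and m: "1 \<le> m"
    and J: "J \<subseteq> {1..n}" "card J \<le> m"
  shows "sum R J \<le> sum R I"
proof -
  have fJ: "finite J" using J(1) by (rule finite_subset) simp
  define P where "P = {i \<in> {1..n}. R i > 0}"
  show ?thesis
  proof (cases "card P \<le> m")
    case True
    with greedy have "I = P" by (simp add: greedy_choice_def P_def Let_def)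
    have "R j \<le> 0" if "j \<in> J - I" for j
    proof -
      have "j \<in> {1..n}" "j \<notin> P"
        using that J(1) \<open>I = P\<close> by blast+
      then show ?thesis by (simp add: P_def)
    qed
    then show ?thesis
      using fJ by (intro sum_le_sum_if_threshold[of I J 0]) (auto simp: \<open>I = P\<close> P_def)
  next
    case False
    with greedy have I: "I \<subseteq> {1..n}" "card I = m"
      and largest: "\<And>i j. i \<in> I \<Longrightarrow> j \<in> {1..n} - I \<Longrightarrow> R j \<le> R i"
      by (auto simp: greedy_choice_def P_def Let_def largest_indices_def)
    have fI: "finite I" using I(1) by (rule finite_subset) simp
    have "I \<noteq> {}" using I(2) m by auto
    then have Min_in: "Min (R ` I) \<in> R ` I" using fI by simp
    \<comment> \<open>The positive terms do not all fit into \<open>I\<close>, and a positive term left out of \<open>I\<close> forces the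
      smallest term in \<open>I\<close>, the threshold, to be positive.\<close>
    have "\<not> P \<subseteq> I" using card_mono[OF fI] False I(2) by auto
    then obtain j where "j \<in> P" "j \<notin> I" by blast
    then have "0 \<le> Min (R ` I)" using Min_in largest by (fastforce simp: P_def)
    then show ?thesis
      using fI fJ I(2) J Min_in largest
      by (intro sum_le_sum_if_threshold[of I J "Min (R ` I)"]) auto
  qed
qed

section \<open>The expected reward as a sum over signals\<close>

lemma finite_signals: "finite (signals n)"
  unfolding signals_def by (intro finite_PiE) auto

lemma finite_allocations: "finite (allocations n k)"
  by (rule finite_subset[OF _ finite_signals[of n]]) (auto simp: allocations_def signals_def)

context test_and_find
begin

lemma joint_event:
  "{\<omega> \<in> space M. S \<omega> = s \<and> T \<omega> = \<gamma>} \<in> events"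
proof -
  have "(S -` ({s} \<inter> signals n) \<inter> space M) \<inter> (T -` ({\<gamma>} \<inter> allocations n k) \<inter> space M) \<in> events"
    by (rule sets.Int; rule measurable_sets[OF measurable_S] measurable_sets[OF measurable_T]; simp)
  moreover have "(S -` ({s} \<inter> signals n) \<inter> space M) \<inter> (T -` ({\<gamma>} \<inter> allocations n k) \<inter> space M)
      = {\<omega> \<in> space M. S \<omega> = s \<and> T \<omega> = \<gamma>}"
    using measurable_space[OF measurable_S] measurable_space[OF measurable_T] by auto
  ultimately show ?thesis by simp
qed

lemma prob_allocation: "\<P>(\<omega> in M. T \<omega> = \<gamma>) = pmf \<pi> \<gamma>"
proof -
  have "T -` X \<inter> space M \<in> events" for X
  proof -
    have "T -` X \<inter> space M = T -` (X \<inter> allocations n k) \<inter> space M"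
      using measurable_space[OF measurable_T] by auto
    then show ?thesis using measurable_sets[OF measurable_T, of "X \<inter> allocations n k"] by simp
  qed
  then have "T \<in> M \<rightarrow>\<^sub>M count_space UNIV" by (intro measurableI) auto
  then have "measure (distr M (count_space UNIV) T) {\<gamma>} = prob (T -` {\<gamma>} \<inter> space M)"
    by (rule measure_distr) simp
  moreover have "T -` {\<gamma>} \<inter> space M = {\<omega> \<in> space M. T \<omega> = \<gamma>}" by auto
  ultimately show ?thesis by (simp add: distr_T measure_pmf_single)
qed

lemma prob_signal_allocation:
  assumes "s \<in> signals n" "\<gamma> \<in> allocations n k"
  shows "\<P>(\<omega> in M. S \<omega> = s \<and> T \<omega> = \<gamma>) = pmf \<pi> \<gamma> * likelihood n a b s \<gamma>"
proof (cases "\<P>(\<omega> in M. T \<omega> = \<gamma>) > 0")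
  case True
  then show ?thesis
    using cond_prob_signal[OF assms(2,1) True] prob_allocation[of \<gamma>]
    by (simp add: cond_prob_def field_simps)
next
  \<comment> \<open>The conditional law of the signal is unconstrained here, but both sides vanish.\<close>
  case False
  have T: "{\<omega> \<in> space M. T \<omega> = \<gamma>} \<in> events"
  proof -
    have "{\<omega> \<in> space M. T \<omega> = \<gamma>} = T -` {\<gamma>} \<inter> space M" by auto
    then show ?thesis using measurable_sets[OF measurable_T, of "{\<gamma>}"] assms(2) by simp
  qed
  from False have "\<P>(\<omega> in M. T \<omega> = \<gamma>) = 0"
    by (meson linorder_not_less measure_nonneg order_antisym)
  moreover have "\<P>(\<omega> in M. S \<omega> = s \<and> T \<omega> = \<gamma>) \<le> \<P>(\<omega> in M. T \<omega> = \<gamma>)"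
    by (intro finite_measure_mono T) auto
  ultimately show ?thesis
    using prob_allocation[of \<gamma>] by (simp add: order_antisym)
qed

lemma expectation_signal_allocation:
  fixes g :: "(nat \<Rightarrow> nat) \<Rightarrow> (nat \<Rightarrow> nat) \<Rightarrow> real"
  shows "expectation (\<lambda>\<omega>. g (S \<omega>) (T \<omega>)) =
    (\<Sum>s\<in>signals n. \<Sum>\<gamma>\<in>allocations n k. pmf \<pi> \<gamma> * likelihood n a b s \<gamma> * g s \<gamma>)"
proof -
  let ?E = "\<lambda>s \<gamma>. {\<omega> \<in> space M. S \<omega> = s \<and> T \<omega> = \<gamma>}"
  have "g (S \<omega>) (T \<omega>) =
      (\<Sum>s\<in>signals n. \<Sum>\<gamma>\<in>allocations n k. indicator (?E s \<gamma>) \<omega> * g s \<gamma>)"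
    if \<omega>: "\<omega> \<in> space M" for \<omega>
  proof -
    have "S \<omega> \<in> signals n" "T \<omega> \<in> allocations n k"
      using measurable_space[OF measurable_S \<omega>] measurable_space[OF measurable_T \<omega>] by auto
    moreover have "indicator (?E s \<gamma>) \<omega> * g s \<gamma> =
        (if S \<omega> = s then if T \<omega> = \<gamma> then g s \<gamma> else 0 else 0)" for s \<gamma>
      using \<omega> by simp
    moreover have "(\<Sum>\<gamma>\<in>A. if P then f \<gamma> else 0) = (if P then sum f A else 0)"
      for A and P and f :: "(nat \<Rightarrow> nat) \<Rightarrow> real" by simp
    ultimately show ?thesis
      by (simp add: finite_signals finite_allocations)
  qed
  then have "expectation (\<lambda>\<omega>. g (S \<omega>) (T \<omega>)) =
      expectation (\<lambda>\<omega>. \<Sum>s\<in>signals n. \<Sum>\<gamma>\<in>allocations n k. indicator (?E s \<gamma>) \<omega> * g s \<gamma>)"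
    by (intro Bochner_Integration.integral_cong) auto
  also have "\<dots> = (\<Sum>s\<in>signals n. \<Sum>\<gamma>\<in>allocations n k. prob (?E s \<gamma>) * g s \<gamma>)"
  proof -
    have int: "integrable M (\<lambda>\<omega>. indicator (?E s \<gamma>) \<omega> * g s \<gamma>)" for s \<gamma>
      using joint_event[of s \<gamma>] by (auto simp: emeasure_eq_measure)
    have "?E s \<gamma> \<inter> space M = ?E s \<gamma>" for s \<gamma> by auto
    then show ?thesis
      using int by (simp add: Bochner_Integration.integral_sum)
  qed
  finally show ?thesis by (simp add: prob_signal_allocation)
qed

text \<open>
  This is Bayes' rule with the normalizing constant multiplied out. If the signal has probability
  zero, the posterior is a division by zero, but then all joint probabilities vanish as well.
\<close>

lemma sum_joint_prob_reward:
  assumes s: "s \<in> signals n" and i: "i \<in> {1..n}"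
  shows "(\<Sum>\<gamma>\<in>allocations n k. pmf \<pi> \<gamma> * likelihood n a b s \<gamma> *
            (c i * of_bool (\<gamma> i = 1) - d i * of_bool (\<gamma> i = 0))) =
         signal_prob n k a b \<pi> s * tag_value n k a b c d \<pi> s i"
proof -
  let ?A = "allocations n k"
  define w where "w \<gamma> = pmf \<pi> \<gamma> * likelihood n a b s \<gamma>" for \<gamma>
  have nonneg: "0 \<le> w \<gamma>" if "\<gamma> \<in> ?A" for \<gamma>
    using prob_signal_allocation[OF s that, symmetric] by (simp add: w_def)
  define q where "q = sum w {\<gamma> \<in> ?A. \<gamma> i = 0}"
  have p: "signal_prob n k a b \<pi> s = sum w ?A" by (simp add: signal_prob_def w_def)
  have q: "posterior_empty n k a b \<pi> s i = q / sum w ?A"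
    by (simp add: posterior_empty_def w_def q_def)
  have cases: "w \<gamma> * (c i * of_bool (\<gamma> i = 1) - d i * of_bool (\<gamma> i = 0)) =
      c i * w \<gamma> - (c i + d i) * (if \<gamma> i = 0 then w \<gamma> else 0)" if "\<gamma> \<in> ?A" for \<gamma>
  proof -
    have "\<gamma> i = 0 \<or> \<gamma> i = 1" using that i by (auto simp: allocations_def PiE_iff)
    then show ?thesis by (auto simp: algebra_simps)
  qed
  have "(\<Sum>\<gamma>\<in>?A. w \<gamma> * (c i * of_bool (\<gamma> i = 1) - d i * of_bool (\<gamma> i = 0))) =
      (\<Sum>\<gamma>\<in>?A. c i * w \<gamma> - (c i + d i) * (if \<gamma> i = 0 then w \<gamma> else 0))"
    by (rule sum.cong[OF refl cases])
  also have "\<dots> = c i * sum w ?A - (c i + d i) * q"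
    by (simp add: sum_subtractf sum_distrib_left[symmetric] q_def
        sum.inter_filter[OF finite_allocations])
  also have "\<dots> = sum w ?A * tag_value n k a b c d \<pi> s i"
  proof (cases "sum w ?A = 0")
    case True
    then have "\<forall>\<gamma>\<in>?A. w \<gamma> = 0"
      using nonneg by (simp add: sum_nonneg_eq_0_iff finite_allocations)
    then have "q = 0" by (simp add: q_def)
    with True show ?thesis by simp
  next
    case False
    then show ?thesis by (simp add: tag_value_def q field_simps)
  qed
  finally show ?thesis by (simp add: p w_def)
qed

lemma signal_prob_nonneg:
  assumes "s \<in> signals n"
  shows "0 \<le> signal_prob n k a b \<pi> s"
  unfolding signal_prob_def
proof (rule sum_nonneg)
  fix \<gamma> assume "\<gamma> \<in> allocations n k"
  from prob_signal_allocation[OF assms this, symmetric]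
  show "0 \<le> pmf \<pi> \<gamma> * likelihood n a b s \<gamma>" by simp
qed

lemma expected_reward_eq_sum_tag_values:
  assumes J: "J \<in> strategies n m"
  shows "expected_reward M c d T S J =
    (\<Sum>s\<in>signals n. signal_prob n k a b \<pi> s * (\<Sum>i\<in>J s. tag_value n k a b c d \<pi> s i))"
proof -
  let ?r = "\<lambda>\<gamma> i. c i * of_bool (\<gamma> i = 1) - d i * of_bool (\<gamma> i = (0::nat))"
  have "expected_reward M c d T S J =
      (\<Sum>s\<in>signals n. \<Sum>\<gamma>\<in>allocations n k. pmf \<pi> \<gamma> * likelihood n a b s \<gamma> * (\<Sum>i\<in>J s. ?r \<gamma> i))"
    unfolding expected_reward_def
    by (rule expectation_signal_allocation[where g = "\<lambda>s \<gamma>. \<Sum>i\<in>J s. ?r \<gamma> i"])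
  also have "\<dots> =
      (\<Sum>s\<in>signals n. \<Sum>i\<in>J s. \<Sum>\<gamma>\<in>allocations n k. pmf \<pi> \<gamma> * likelihood n a b s \<gamma> * ?r \<gamma> i)"
    unfolding sum_distrib_left by (rule sum.cong[OF refl sum.swap])
  also have "\<dots> = (\<Sum>s\<in>signals n. \<Sum>i\<in>J s.
      signal_prob n k a b \<pi> s * tag_value n k a b c d \<pi> s i)"
    using J by (intro sum.cong refl sum_joint_prob_reward) (auto simp: strategies_def dest!: funcset_mem)
  finally show ?thesis by (simp add: sum_distrib_left)
qed

end

section \<open>Optimality of the greedy strategy\<close>

theorem theorem1:
  fixes M :: "'w measure"
    and n k m :: nat
    and a b c d :: "nat \<Rightarrow> real"
    and \<pi> :: "(nat \<Rightarrow> nat) pmf"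
    and T S :: "'w \<Rightarrow> nat \<Rightarrow> nat"
    and I :: "(nat \<Rightarrow> nat) \<Rightarrow> nat set"
  assumes "test_and_find M n k m a b \<pi> T S"
    and "I \<in> strategies n m"
    and "\<And>s. s \<in> signals n \<Longrightarrow> signal_prob n k a b \<pi> s > 0 \<Longrightarrow>
           greedy_choice n m (tag_value n k a b c d \<pi> s) (I s)"
  shows "is_arg_max (expected_reward M c d T S) (\<lambda>J. J \<in> strategies n m) I"
proof -
  interpret test_and_find M n k m a b \<pi> T S by (rule assms(1))
  have "expected_reward M c d T S J \<le> expected_reward M c d T S I"
    if J: "J \<in> strategies n m" for J
    unfolding expected_reward_eq_sum_tag_values[OF J] expected_reward_eq_sum_tag_values[OF assms(2)]
  proof (rule sum_mono)
    fix s assume s: "s \<in> signals n"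
    let ?p = "signal_prob n k a b \<pi> s" and ?R = "tag_value n k a b c d \<pi> s"
    show "?p * sum ?R (J s) \<le> ?p * sum ?R (I s)"
    proof (cases "?p > 0")
      case True
      have "J s \<subseteq> {1..n}" "card (J s) \<le> m" using J s by (auto simp: strategies_def)
      then have "sum ?R (J s) \<le> sum ?R (I s)"
        by (rule greedy_choice_maximizes_sum[OF assms(3)[OF s True] m_ge_1])
      with True show ?thesis by simp
    next
      case False
      with signal_prob_nonneg[OF s] show ?thesis by simp
    qed
  qed
  with assms(2) show ?thesis by (simp add: is_arg_max_linorder)
qed

end
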